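(* (Syllogisms with generalized quantifiers.) Let $S,M,P$ be three logically independent events. Then the following probabilistic inferences are strictly valid ($\models_s$): \begin{itemize} \item (generalized Baroco, Figure II) for every $y_1\in(0,1]$: $(p(M|P)=1,\ p(\overline{M}|S)\ge y_1,\ p(S|(S\vee P))>0)\ \models_s\ p(\overline{P}|S)\ge y_1$; \item (generalized Darii, Figure I) for every $y_1\in(0,1]$: $(p(P|M)=1,\ p(M|S)\ge y_1,\ p(S|(S\vee M))>0)\ \models_s\ p(P|S)\ge y_1$; \item (weakened Darapti, Figure III) for every $x_1\in(0.5,1]$: $(p(P|M)\ge x_1,\ p(S|M)\ge x_1,\ p(M|(S\vee M))>0)\ \models_s\ p(P|S)>0$. \end{itemize}
   Context: Events are elements of a Boolean algebra (e.g. subsets of a set $\Omega$), identified with their $\{0,1\}$-valued indicators; $\overline{E}$ is the negation of $E$ and juxtaposition or $\wedge$ is conjunction. Three events are logically independent if all $8$ conjunctions obtained by choosing each of them or its negation are different from the impossible event $\bot$. For events $E,H$ with $H\ne\bot$, the conditional event $E|H$ is true if $EH$ is true, false if $\overline{E}H$ is true, and void if $H$ is false. Coherence: an assessment $\mathcal P=(p_1,\dots,p_n)\in\mathbb R^n$ on $\mathcal F=(E_1|H_1,\dots,E_n|H_n)$ is coherent if for every nonempty $J\subseteq\{1,\dots,n\}$ and all real numbers $s_j$ ($j\in J$), the random gain $G=\sum_{j\in J}s_jH_j(E_j-p_j)$, restricted to $\bigvee_{j\in J}H_j$ (i.e. considering only its values when at least one $H_j$, $j\in J$, is true), has minimum $\le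 0$ and maximum $\ge 0$. An imprecise assessment on $\mathcal F$ is a set $\mathcal I\subseteq[0,1]^n$; it is g-coherent if it contains at least one coherent assessment. The set $\Sigma$ of coherent extensions of $\mathcal I$ to a further conditional event $E_{n+1}|H_{n+1}$ is the set of all $z\in[0,1]$ such that, for some coherent $\mathcal P\in\mathcal I$, the assessment $(\mathcal P,z)$ on $(\mathcal F,E_{n+1}|H_{n+1})$ is coherent. For a g-coherent $\mathcal I$ on $\mathcal F$ and a nonempty $\mathcal I'\subseteq[0,1]$, the inference "from $\mathcal I$ on $\mathcal F$ infer $\mathcal I'$ on $E_{n+1}|H_{n+1}$" is strictly valid ($\models_s$) if $\Sigma=\mathcal I'$. A list of constraints $p(E_i|H_i)\in\mathcal I_i$ stands for the imprecise assessment $\mathcal I_1\times\cdots\times\mathcal I_n$; all probabilities range in $[0,1]$, so "$=1$" is $\{1\}$, "$>0$" is $(0,1]$, and "$\ge a$" is $[a,1]$. *)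

theory Defs
  imports "HOL-Analysis.Analysis"
begin

(* The pair (E, H) stands for the conditional event E|H; the condition that H differs from bot
   is imposed in the definition of coherence. *)
type_synonym 'a cond_event = "'a \<times> 'a"

definition logically_independent3 :: "'a::boolean_algebra \<Rightarrow> 'a \<Rightarrow> 'a \<Rightarrow> bool" where
  "logically_independent3 A B C \<longleftrightarrow>
     (\<forall>X\<in>{A, - A}. \<forall>Y\<in>{B, - B}. \<forall>Z\<in>{C, - C}. inf X (inf Y Z) \<noteq> bot)"

(* The possible joint truth values of a finite set of events: each constituent affirms the members
   of B and negates the others, and is not the impossible event. *)
definition constituents :: "'a::boolean_algebra set \<Rightarrow> 'a set" where
  "constituents \<A> =
     {C. C \<noteq> bot \<and> (\<exists>B\<subseteq>\<A>. C = Inf_fin (insert top (B \<union> uminus ` (\<A> - B))))}"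

(* Value of the indicator of A on a constituent C of a set of events containing A:
   there, either C \<le> A or C \<le> - A. *)
definition ind :: "'a::boolean_algebra \<Rightarrow> 'a \<Rightarrow> real" where
  "ind A C = (if C \<le> A then 1 else 0)"

definition gain ::
  "'a::boolean_algebra cond_event list \<Rightarrow> real list \<Rightarrow> (nat \<Rightarrow> real) \<Rightarrow> nat set \<Rightarrow> 'a \<Rightarrow> real" where
  "gain F p s J C =
     (\<Sum>j\<in>J. s j * ind (snd (F ! j)) C * (ind (fst (F ! j)) C - p ! j))"

(* Constituents of the events E_j, H_j (j in J) on which at least one H_j is true. *)
definition relevant_constituents ::
  "'a::boolean_algebra cond_event list \<Rightarrow> nat set \<Rightarrow> 'a set" where
  "relevant_constituents F J =
     {C \<in> constituents ((\<lambda>j. fst (F ! j)) ` J \<union> (\<lambda>j. snd (F ! j)) ` J).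
        \<exists>j\<in>J. C \<le> snd (F ! j)}"

(* The family is indexed by {..<length F}. When all H_j differ from bot and J is nonempty and
   finite, the set of relevant constituents is finite and nonempty, so Min and Max are proper. *)
definition coherent :: "'a::boolean_algebra cond_event list \<Rightarrow> real list \<Rightarrow> bool" where
  "coherent F p \<longleftrightarrow>
     length p = length F \<and>
     (\<forall>(E, H)\<in>set F. H \<noteq> bot) \<and>
     (\<forall>J s. J \<noteq> {} \<longrightarrow> J \<subseteq> {..<length F} \<longrightarrow>
        Min (gain F p s J ` relevant_constituents F J) \<le> 0 \<and>
        Max (gain F p s J ` relevant_constituents F J) \<ge> 0)"

definition imprecise_assessment ::
  "'a::boolean_algebra cond_event list \<Rightarrow> real list set \<Rightarrow> bool" where
  "imprecise_assessment F \<I> \<longleftrightarrow> (\<forall>p\<in>\<I>. length p = length F \<and> set p \<subseteq> {0..1})"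

definition g_coherent :: "'a::boolean_algebra cond_event list \<Rightarrow> real list set \<Rightarrow> bool" where
  "g_coherent F \<I> \<longleftrightarrow> imprecise_assessment F \<I> \<and> (\<exists>p\<in>\<I>. coherent F p)"

definition coherent_extensions ::
  "'a::boolean_algebra cond_event list \<Rightarrow> real list set \<Rightarrow> 'a cond_event \<Rightarrow> real set" where
  "coherent_extensions F \<I> K =
     {z \<in> {0..1}. \<exists>p\<in>\<I>. coherent F p \<and> coherent (F @ [K]) (p @ [z])}"

definition strictly_valid ::
  "'a::boolean_algebra cond_event list \<Rightarrow> real list set \<Rightarrow> 'a cond_event \<Rightarrow> real set \<Rightarrow> bool" where
  "strictly_valid F \<I> K \<I>' \<longleftrightarrow>
     g_coherent F \<I> \<and> \<I>' \<noteq> {} \<and> \<I>' \<subseteq> {0..1} \<and> coherent_extensions F \<I> K = \<I>'"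

end

theory Submission
  imports Defs
begin

text \<open>
  The three events generate a Boolean algebra with eight atoms, and every event that occurs in the
  inferences is a union of atoms. The gain of a bet takes the same values on the atoms as on the
  constituents of the events that are bet on (\<open>gain_relevant_constituents\<close>), so coherence can be
  tested on truth assignments to \<open>(S, M, P)\<close>.

  Each inference then has two halves. That every value \<open>z\<close> of the claimed set is attained is shown by
  a probability on the atoms that gives positive mass to all conditioning events: a bet is fair under
  it, hence cannot be a sure gain (\<open>coherent_of_weights\<close>). For Darii and Darapti the mass is \<open>z\<close> on
  \<open>SMP\<close> and \<open>1 - z\<close> on \<open>S\<close> with \<open>M\<close> and \<open>P\<close> negated. For Baroco it is \<open>z\<close> on \<open>S\<close> with \<open>M\<close> and \<open>P\<close>
  negated, \<open>1 - z\<close> on \<open>SMP\<close>, and, to keep \<open>P\<close> possible when \<open>z = 1\<close>, an extra unit on \<open>MP\<close> with \<open>S\<close>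
  negated (the masses need not be normalized).

  That no other value is coherent is shown by a Dutch book (\<open>not_coherent_of_sure_gain\<close>). The stakes
  mirror the elementary argument with probabilities. In Darii the first premise kills
  \<open>S \<and> M \<and> \<not> P\<close>, whence \<open>p(P|S) \<ge> p(M|S)\<close>; accordingly one backs \<open>P|S\<close>, bets against \<open>M|S\<close> with the
  same stake, and bets heavily against the first premise to pay for the excluded atoms. This gains
  at least the difference of the two prices when \<open>S\<close> is true; a small stake against \<open>S|(S \<or> M)\<close>, which has a
  positive price, makes the gain positive when \<open>S\<close> is false too. Baroco has the same stakes. In
  Darapti the reason is \<open>p(PS|M) \<ge> p(P|M) + p(S|M) - 1 > 0\<close>: unit bets against both premises have a
  positive total gain on all atoms of \<open>M\<close> but \<open>SMP\<close>, where their loss is covered by backing \<open>P|S\<close>,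
  which costs nothing at price \<open>0\<close>; a small stake against \<open>M|(S \<or> M)\<close> takes care of \<open>M\<close> being false.
\<close>

section \<open>Gains on a resolving family of events\<close>

text \<open>The inequality of truth values says that exactly one alternative holds; in particular a
  deciding event is possible.\<close>
definition decides :: "'a::boolean_algebra \<Rightarrow> 'a \<Rightarrow> bool" where
  "decides C A \<longleftrightarrow> (C \<le> A) \<noteq> (C \<le> - A)"

lemma decidesI:
  fixes C :: "'a::boolean_algebra"
  assumes "C \<noteq> bot" "C \<le> A \<or> C \<le> - A"
  shows "decides C A"
proof -
  have False if "C \<le> A" "C \<le> - A"
  proof -
    have "C \<le> inf A (- A)" using that by (rule inf_greatest)
    then show False using assms(1) by (simp add: bot_unique)
  qed
  then show ?thesis using assms(2) unfolding decides_def by blast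
qed

lemma decides_uminus_iff: "decides C A \<Longrightarrow> C \<le> - A \<longleftrightarrow> \<not> C \<le> A"
  unfolding decides_def by blast

lemma decides_sup_iff:
  fixes C :: "'a::boolean_algebra"
  assumes "decides C A"
  shows "C \<le> sup A B \<longleftrightarrow> C \<le> A \<or> C \<le> B"
proof -
  have "C \<le> B" if "C \<le> - A" "C \<le> sup A B"
  proof -
    have "C \<le> inf (- A) (sup A B)" using that by (rule inf_greatest)
    also have "\<dots> \<le> B" by (simp add: inf_sup_distrib1)
    finally show ?thesis .
  qed
  then show ?thesis using assms unfolding decides_def by (auto intro: le_supI1 le_supI2)
qed

lemma decides_agree:
  fixes C :: "'a::boolean_algebra"
  assumes "decides C A" "decides D A" "inf C D \<noteq> bot"
  shows "C \<le> A \<longleftrightarrow> D \<le> A"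
proof -
  have "inf C D = bot" if "C \<le> X" "D \<le> - X" for X
  proof -
    have "inf C D \<le> inf X (- X)" using that by (rule inf_mono)
    then show ?thesis by (simp add: bot_unique)
  qed
  from this[of A] this[of "- A"] show ?thesis using assms unfolding decides_def by auto
qed

definition resolves :: "('i \<Rightarrow> 'a::boolean_algebra) \<Rightarrow> 'a set \<Rightarrow> bool" where
  "resolves \<alpha> \<A> \<longleftrightarrow>
     (\<forall>C. C \<noteq> bot \<longrightarrow> (\<exists>i. inf (\<alpha> i) C \<noteq> bot)) \<and> (\<forall>i. \<forall>A\<in>\<A>. decides (\<alpha> i) A)"

lemma constituent_decides:
  assumes "finite \<A>" "C \<in> constituents \<A>" "A \<in> \<A>"
  shows "decides C A"
proof -
  obtain B where B: "C \<noteq> bot" "C = Inf_fin (insert top (B \<union> uminus ` (\<A> - B)))" "B \<subseteq> \<A>"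
    using assms(2) unfolding constituents_def by blast
  have fin: "finite (insert top (B \<union> uminus ` (\<A> - B)))"
    using B(3) assms(1) by (auto intro: finite_subset)
  have "A \<in> insert top (B \<union> uminus ` (\<A> - B)) \<or> - A \<in> insert top (B \<union> uminus ` (\<A> - B))"
    using assms(3) by blast
  then have "C \<le> A \<or> C \<le> - A" unfolding B(2) using Inf_fin.coboundedI[OF fin] by blast
  with B(1) show ?thesis by (rule decidesI)
qed

lemma constituent_above:
  assumes "finite \<A>" "C \<noteq> bot" "\<forall>A\<in>\<A>. decides C A"
  shows "\<exists>D\<in>constituents \<A>. C \<le> D"
proof -
  define B where "B = {A \<in> \<A>. C \<le> A}"
  define D where "D = Inf_fin (insert top (B \<union> uminus ` (\<A> - B)))"
  have "C \<le> D" unfolding D_def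
  proof (rule Inf_fin.boundedI)
    show "finite (insert top (B \<union> uminus ` (\<A> - B)))"
      using assms(1) by (simp add: B_def)
  qed (use assms(3) in \<open>auto simp: B_def decides_def\<close>)
  moreover from this have "D \<noteq> bot" using assms(2) by (auto simp: bot_unique)
  moreover have "B \<subseteq> \<A>" by (auto simp: B_def)
  ultimately have "D \<in> constituents \<A>"
    unfolding constituents_def using D_def by (intro CollectI conjI exI[of _ B])
  with \<open>C \<le> D\<close> show ?thesis by blast
qed

lemma gain_cong:
  assumes "\<And>j. j \<in> J \<Longrightarrow> C \<le> fst (F ! j) \<longleftrightarrow> D \<le> fst (F ! j)"
    and "\<And>j. j \<in> J \<Longrightarrow> C \<le> snd (F ! j) \<longleftrightarrow> D \<le> snd (F ! j)"
  shows "gain F p s J C = gain F p s J D"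
  unfolding gain_def ind_def by (rule sum.cong) (simp_all add: assms)

abbreviation events :: "'a cond_event list \<Rightarrow> 'a set" where
  "events F \<equiv> fst ` set F \<union> snd ` set F"

text \<open>A member of the resolving family and a constituent that have a possible conjunction agree on
  all events of the bet, and each object of one kind meets one of the other kind.\<close>
lemma gain_relevant_constituents:
  assumes res: "resolves \<alpha> (events F)" and J: "J \<subseteq> {..<length F}"
  shows "gain F p s J ` relevant_constituents F J =
         (\<lambda>i. gain F p s J (\<alpha> i)) ` {i. \<exists>j\<in>J. \<alpha> i \<le> snd (F ! j)}"
proof -
  define \<A> where "\<A> = (\<lambda>j. fst (F ! j)) ` J \<union> (\<lambda>j. snd (F ! j)) ` J"
  have fin: "finite \<A>" unfolding \<A>_def using J by (auto intro: finite_subset)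
  have "\<A> \<subseteq> events F" unfolding \<A>_def using J by auto
  then have dec: "decides (\<alpha> i) A" if "A \<in> \<A>" for i A
    using res that unfolding resolves_def by blast
  have mem: "fst (F ! j) \<in> \<A>" "snd (F ! j) \<in> \<A>" if "j \<in> J" for j
    using that unfolding \<A>_def by auto
  have meet: "gain F p s J C = gain F p s J (\<alpha> i) \<and>
      ((\<exists>j\<in>J. C \<le> snd (F ! j)) \<longleftrightarrow> (\<exists>j\<in>J. \<alpha> i \<le> snd (F ! j)))"
    if "C \<in> constituents \<A>" "inf (\<alpha> i) C \<noteq> bot" for C i
  proof -
    have "C \<le> A \<longleftrightarrow> \<alpha> i \<le> A" if "A \<in> \<A>" for A
      using decides_agree[OF dec[OF that] constituent_decides[OF fin \<open>C \<in> _\<close> that] \<open>inf _ _ \<noteq> _\<close>]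
      by simp
    then show ?thesis using mem by (auto intro!: gain_cong)
  qed
  have meets: "\<exists>i. inf (\<alpha> i) C \<noteq> bot" if "C \<in> constituents \<A>" for C
    using that res unfolding constituents_def resolves_def by blast
  have met: "\<exists>C\<in>constituents \<A>. inf (\<alpha> i) C \<noteq> bot" if "\<alpha> i \<le> snd (F ! j)" "j \<in> J" for i j
  proof -
    have "\<alpha> i \<noteq> bot" using dec[OF mem(1)[OF that(2)], of i] unfolding decides_def by auto
    then show ?thesis
      using constituent_above[OF fin, of "\<alpha> i"] dec by (metis inf.absorb1)
  qed
  have rel: "relevant_constituents F J = {C \<in> constituents \<A>. \<exists>j\<in>J. C \<le> snd (F ! j)}"
    unfolding relevant_constituents_def \<A>_def ..
  show ?thesis
  proof (intro equalityI subsetI)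
    fix x assume "x \<in> gain F p s J ` relevant_constituents F J"
    then obtain C where C: "x = gain F p s J C" "C \<in> constituents \<A>" "\<exists>j\<in>J. C \<le> snd (F ! j)"
      unfolding rel by auto
    obtain i where "inf (\<alpha> i) C \<noteq> bot" using meets[OF C(2)] by blast
    with meet[OF C(2)] C show "x \<in> (\<lambda>i. gain F p s J (\<alpha> i)) ` {i. \<exists>j\<in>J. \<alpha> i \<le> snd (F ! j)}"
      by auto
  next
    fix x assume "x \<in> (\<lambda>i. gain F p s J (\<alpha> i)) ` {i. \<exists>j\<in>J. \<alpha> i \<le> snd (F ! j)}"
    then obtain i where i: "x = gain F p s J (\<alpha> i)" "\<exists>j\<in>J. \<alpha> i \<le> snd (F ! j)" by auto
    then obtain C where C: "C \<in> constituents \<A>" "inf (\<alpha> i) C \<noteq> bot" using met by blast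
    with meet[OF C] i have "x = gain F p s J C" "C \<in> relevant_constituents F J"
      unfolding rel by auto
    then show "x \<in> gain F p s J ` relevant_constituents F J" by blast
  qed
qed

section \<open>Coherence from weights, incoherence from sure gains\<close>

text \<open>The weights act as an unnormalized probability: the weighted sum of the gains vanishes, while the gains vanish wherever no bet is called and
  some called bet has positive weight. So the gains on the relevant part cannot all have the same
  strict sign.\<close>
lemma coherent_of_weights:
  fixes \<alpha> :: "'i::finite \<Rightarrow> 'a::boolean_algebra" and w :: "'i \<Rightarrow> real"
  assumes res: "resolves \<alpha> (events F)" and len: "length p = length F"
    and w: "\<And>i. w i \<ge> 0"
    and bets: "\<forall>((E, H), x)\<in>set (zip F p). (\<Sum>i\<in>UNIV. w i * ind H (\<alpha> i)) > 0 \<and>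
      (\<Sum>i\<in>UNIV. w i * (ind H (\<alpha> i) * (ind E (\<alpha> i) - x))) = 0"
  shows "coherent F p"
proof -
  have pos: "(\<Sum>i\<in>UNIV. w i * ind (snd (F ! j)) (\<alpha> i)) > 0"
    and fair: "(\<Sum>i\<in>UNIV. w i * (ind (snd (F ! j)) (\<alpha> i) * (ind (fst (F ! j)) (\<alpha> i) - p ! j))) = 0"
    if "j < length F" for j
  proof -
    have "(F ! j, p ! j) \<in> set (zip F p)" using that len by (auto simp: in_set_zip)
    then show "(\<Sum>i\<in>UNIV. w i * ind (snd (F ! j)) (\<alpha> i)) > 0"
      "(\<Sum>i\<in>UNIV. w i * (ind (snd (F ! j)) (\<alpha> i) * (ind (fst (F ! j)) (\<alpha> i) - p ! j))) = 0"
      using bets by (auto simp: case_prod_beta)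
  qed
  have dec: "decides (\<alpha> i) A" if "A \<in> events F" for i A
    using res that unfolding resolves_def by blast
  have nonbot: "H \<noteq> bot" if EH: "(E, H) \<in> set F" for E H
  proof
    assume "H = bot"
    have "\<not> \<alpha> i \<le> bot" for i
    proof
      assume "\<alpha> i \<le> bot"
      then have "\<alpha> i \<le> H" "\<alpha> i \<le> - H" by (simp_all add: bot_unique)
      moreover have "decides (\<alpha> i) H" using dec EH by force
      ultimately show False unfolding decides_def by blast
    qed
    moreover obtain j where "j < length F" "F ! j = (E, H)" using EH by (metis in_set_conv_nth)
    ultimately show False using pos[of j] \<open>H = bot\<close> by (simp add: ind_def)
  qed
  have no_sure_gain: "\<exists>i\<in>{i. \<exists>j\<in>J. \<alpha> i \<le> snd (F ! j)}. gain F p s J (\<alpha> i) \<le> 0"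
    if J: "J \<noteq> {}" "J \<subseteq> {..<length F}" for J s
  proof (rule ccontr)
    assume "\<not> ?thesis"
    then have gpos: "gain F p s J (\<alpha> i) > 0" if "\<exists>j\<in>J. \<alpha> i \<le> snd (F ! j)" for i
      using that by force
    have gzero: "gain F p s J (\<alpha> i) = 0" if "\<not> (\<exists>j\<in>J. \<alpha> i \<le> snd (F ! j))" for i
      using that unfolding gain_def ind_def by (intro sum.neutral) auto
    have "(\<Sum>i\<in>UNIV. w i * gain F p s J (\<alpha> i)) =
        (\<Sum>j\<in>J. s j *
          (\<Sum>i\<in>UNIV. w i * (ind (snd (F ! j)) (\<alpha> i) * (ind (fst (F ! j)) (\<alpha> i) - p ! j))))"
      unfolding gain_def sum_distrib_left
      by (subst sum.swap) (simp add: mult_ac)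
    also have "\<dots> = 0" using fair J(2) by (intro sum.neutral) auto
    finally have "(\<Sum>i\<in>UNIV. w i * gain F p s J (\<alpha> i)) = 0" .
    moreover have nonneg: "w i * gain F p s J (\<alpha> i) \<ge> 0" for i
      using w gpos[of i] gzero[of i] by (cases "\<exists>j\<in>J. \<alpha> i \<le> snd (F ! j)") auto
    ultimately have zero: "w i * gain F p s J (\<alpha> i) = 0" for i
      by (simp add: sum_nonneg_eq_0_iff)
    obtain j where j: "j \<in> J" using J(1) by blast
    then have "(\<Sum>i\<in>UNIV. w i * ind (snd (F ! j)) (\<alpha> i)) \<noteq> 0" using pos[of j] J(2) by auto
    then obtain i where "w i * ind (snd (F ! j)) (\<alpha> i) \<noteq> 0" by (meson sum.neutral)
    then have "w i \<noteq> 0" "\<alpha> i \<le> snd (F ! j)" by (auto simp: ind_def split: if_splits)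
    with zero[of i] gpos[of i] j show False by force
  qed
  have "Min (gain F p s J ` relevant_constituents F J) \<le> 0 \<and>
        Max (gain F p s J ` relevant_constituents F J) \<ge> 0"
    if J: "J \<noteq> {}" "J \<subseteq> {..<length F}" for J s
  proof -
    have fin: "finite (gain F p s J ` relevant_constituents F J)"
      unfolding gain_relevant_constituents[OF res J(2)] by simp
    have neg: "gain F p (\<lambda>j. - s j) J C = - gain F p s J C" for C
      unfolding gain_def by (simp add: sum_negf)
    \<comment> \<open>The upper bound is the lower one for the opposite stakes.\<close>
    have "\<exists>g\<in>gain F p s J ` relevant_constituents F J. g \<le> 0"
         "\<exists>g\<in>gain F p s J ` relevant_constituents F J. g \<ge> 0"
      unfolding gain_relevant_constituents[OF res J(2)]
      using no_sure_gain[OF J, of s] no_sure_gain[OF J, of "\<lambda>j. - s j"] by (auto simp: neg)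
    then show ?thesis using fin by (meson Max_ge Min_le order_trans)
  qed
  then show ?thesis unfolding coherent_def using len nonbot by auto
qed

lemma coherent_gain_bounds:
  assumes "coherent F p" "J \<noteq> {}" "J \<subseteq> {..<length F}"
  shows "Min (gain F p s J ` relevant_constituents F J) \<le> 0"
    and "Max (gain F p s J ` relevant_constituents F J) \<ge> 0"
  using assms unfolding coherent_def by simp_all

lemma not_coherent_of_sure_gain:
  fixes \<alpha> :: "'i::finite \<Rightarrow> 'a::boolean_algebra"
  assumes res: "resolves \<alpha> (events F)" and F: "F \<noteq> []"
    and gain: "\<And>i. \<exists>(E, H)\<in>set F. \<alpha> i \<le> H \<Longrightarrow> gain F p s {..<length F} (\<alpha> i) > 0"
  shows "\<not> coherent F p"
proof
  assume coh: "coherent F p"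
  define G where "G = gain F p s {..<length F} ` relevant_constituents F {..<length F}"
  have G: "G = (\<lambda>i. gain F p s {..<length F} (\<alpha> i)) ` {i. \<exists>j\<in>{..<length F}. \<alpha> i \<le> snd (F ! j)}"
    unfolding G_def by (rule gain_relevant_constituents[OF res]) simp
  have Gpos: "g > 0" if gG: "g \<in> G" for g
  proof -
    obtain i j where g: "g = gain F p s {..<length F} (\<alpha> i)" "j < length F" "\<alpha> i \<le> snd (F ! j)"
      using gG unfolding G by auto
    then have "\<exists>(E, H)\<in>set F. \<alpha> i \<le> H" by (intro bexI[of _ "F ! j"]) auto
    with gain show ?thesis unfolding g by blast
  qed
  have "F ! 0 \<in> set F" using F by simp
  then have mem: "snd (F ! 0) \<in> events F" by blast
  have "snd (F ! 0) \<noteq> bot" using coh \<open>F ! 0 \<in> set F\<close> unfolding coherent_def by force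
  then obtain i where i: "inf (\<alpha> i) (snd (F ! 0)) \<noteq> bot"
    using res unfolding resolves_def by blast
  have "\<not> \<alpha> i \<le> - snd (F ! 0)"
  proof
    assume "\<alpha> i \<le> - snd (F ! 0)"
    then have "inf (\<alpha> i) (snd (F ! 0)) \<le> inf (- snd (F ! 0)) (snd (F ! 0))"
      by (rule inf_mono) simp
    with i show False by (simp add: bot_unique)
  qed
  then have "\<alpha> i \<le> snd (F ! 0)" using res mem unfolding resolves_def decides_def by blast
  then have "G \<noteq> {}" using F unfolding G by auto
  moreover have "finite G" unfolding G by simp
  ultimately have "Min G > 0" using Gpos by simp
  moreover have "{..<length F} \<noteq> {}" using F by auto
  then have "Min G \<le> 0" unfolding G_def by (rule coherent_gain_bounds(1)[OF coh _ subset_refl])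
  ultimately show False by simp
qed

lemma coherent_butlast:
  assumes "coherent (F @ [K]) (p @ [z])"
  shows "coherent F p"
proof -
  have len: "length p = length F" using assms unfolding coherent_def by simp
  have bounds: "Min (gain F p s J ` relevant_constituents F J) \<le> 0 \<and>
      Max (gain F p s J ` relevant_constituents F J) \<ge> 0"
    if J: "J \<noteq> {}" "J \<subseteq> {..<length F}" for J s
  proof -
    have *: "(F @ [K]) ! j = F ! j" "(p @ [z]) ! j = p ! j" if "j \<in> J" for j
      using that J(2) len by (auto simp: nth_append)
    have "relevant_constituents (F @ [K]) J = relevant_constituents F J"
      unfolding relevant_constituents_def by (simp add: * cong: image_cong)
    moreover have "gain (F @ [K]) (p @ [z]) s J = gain F p s J"
      unfolding gain_def by (rule ext) (simp add: *)
    moreover have "J \<subseteq> {..<length (F @ [K])}" using J(2) by auto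
    ultimately show ?thesis using coherent_gain_bounds[OF assms J(1), of s] by simp
  qed
  have "\<forall>(E, H)\<in>set F. H \<noteq> bot" using assms unfolding coherent_def by simp
  with len bounds show ?thesis unfolding coherent_def by simp
qed

lemma strictly_validI:
  assumes "imprecise_assessment F \<I>" "\<I>' \<noteq> {}" "\<I>' \<subseteq> {0..1}"
    and attained: "\<And>z. z \<in> \<I>' \<Longrightarrow> \<exists>p\<in>\<I>. coherent (F @ [K]) (p @ [z])"
    and bound: "\<And>p z. p \<in> \<I> \<Longrightarrow> z \<in> {0..1} \<Longrightarrow> coherent (F @ [K]) (p @ [z]) \<Longrightarrow> z \<in> \<I>'"
  shows "strictly_valid F \<I> K \<I>'"
proof -
  have "coherent_extensions F \<I> K = \<I>'"
    unfolding coherent_extensions_def using assms(3) attained bound coherent_butlast by blast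
  moreover have "\<exists>p\<in>\<I>. coherent F p" using assms(2) attained coherent_butlast by blast
  ultimately show ?thesis
    unfolding strictly_valid_def g_coherent_def using assms(1-3) by blast
qed

section \<open>The atoms generated by three events\<close>

fun atom3 :: "'a::boolean_algebra \<Rightarrow> 'a \<Rightarrow> 'a \<Rightarrow> bool \<times> bool \<times> bool \<Rightarrow> 'a" where
  "atom3 A B C (a, b, c) =
     inf (if a then A else - A) (inf (if b then B else - B) (if c then C else - C))"

lemma meets_literal:
  fixes X :: "'a::boolean_algebra"
  assumes "X \<noteq> bot"
  shows "\<exists>a. inf X (if a then A else - A) \<noteq> bot"
proof (rule ccontr)
  assume "\<not> ?thesis"
  then have "inf X A = bot" "inf X (- A) = bot" by (metis (full_types))+
  then have "inf X (sup A (- A)) = bot" unfolding inf_sup_distrib1 by simp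
  then show False using assms by simp
qed

lemma atom3_cover:
  fixes X :: "'a::boolean_algebra"
  assumes "X \<noteq> bot"
  shows "\<exists>i. inf (atom3 A B C i) X \<noteq> bot"
proof -
  obtain a where "inf X (if a then A else - A) \<noteq> bot" using meets_literal[OF assms] by blast
  from meets_literal[OF this] obtain b
    where "inf (inf X (if a then A else - A)) (if b then B else - B) \<noteq> bot" by blast
  from meets_literal[OF this] obtain c
    where "inf (inf (inf X (if a then A else - A)) (if b then B else - B))
        (if c then C else - C) \<noteq> bot" by blast
  then have "inf (atom3 A B C (a, b, c)) X \<noteq> bot" by (simp only: atom3.simps inf.assoc inf.commute inf.left_commute not_False_eq_True)
  then show ?thesis by blast
qed

lemma decides_atom3:
  assumes "logically_independent3 A B C" "X \<in> {A, B, C}"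
  shows "decides (atom3 A B C (a, b, c)) X"
proof (rule decidesI)
  show "atom3 A B C (a, b, c) \<noteq> bot"
    using assms(1) unfolding logically_independent3_def by auto
  show "atom3 A B C (a, b, c) \<le> X \<or> atom3 A B C (a, b, c) \<le> - X"
    using assms(2) by (auto intro: le_infI1 le_infI2)
qed

lemma atom3_le_iff:
  assumes "logically_independent3 A B C"
  shows "atom3 A B C (a, b, c) \<le> A \<longleftrightarrow> a"
    and "atom3 A B C (a, b, c) \<le> B \<longleftrightarrow> b"
    and "atom3 A B C (a, b, c) \<le> C \<longleftrightarrow> c"
proof -
  note d = decides_atom3[OF assms, of _ a b c, unfolded decides_def]
  have "(if a then atom3 A B C (a, b, c) \<le> A else atom3 A B C (a, b, c) \<le> - A)"
       "(if b then atom3 A B C (a, b, c) \<le> B else atom3 A B C (a, b, c) \<le> - B)"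
       "(if c then atom3 A B C (a, b, c) \<le> C else atom3 A B C (a, b, c) \<le> - C)"
    by (auto intro: le_infI1 le_infI2)
  then show "atom3 A B C (a, b, c) \<le> A \<longleftrightarrow> a" "atom3 A B C (a, b, c) \<le> B \<longleftrightarrow> b"
      "atom3 A B C (a, b, c) \<le> C \<longleftrightarrow> c"
    using d[of A] d[of B] d[of C] by (auto simp del: atom3.simps split: if_splits)
qed

lemma decides_compl: "decides D X \<Longrightarrow> decides D (- X)"
  unfolding decides_def by auto

lemma decides_sup:
  fixes D :: "'a::boolean_algebra"
  assumes "decides D X" "decides D Y"
  shows "decides D (sup X Y)"
  using assms decides_sup_iff[OF assms(1), of Y]
  unfolding decides_def by auto

lemma sum_truth_assignments:
  fixes f :: "bool \<times> bool \<times> bool \<Rightarrow> real"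
  shows "(\<Sum>i\<in>UNIV. f i) =
    f (True, True, True) + f (True, True, False) + f (True, False, True) + f (True, False, False) +
    f (False, True, True) + f (False, True, False) + f (False, False, True) + f (False, False, False)"
  unfolding UNIV_Times_UNIV[symmetric] sum.cartesian_product'[symmetric]
  by (simp add: UNIV_bool algebra_simps)

section \<open>The syllogisms\<close>

lemma mem_listset3:
  "p \<in> listset [X, Y, Z] \<longleftrightarrow> (\<exists>x\<in>X. \<exists>y\<in>Y. \<exists>z\<in>Z. p = [x, y, z])"
  by (auto simp: set_Cons_def)

lemma listset3_iff: "[x, y, z] \<in> listset [X, Y, Z] \<longleftrightarrow> x \<in> X \<and> y \<in> Y \<and> z \<in> Z"
  unfolding mem_listset3 by auto

text \<open>A bet with stake \<open>e\<close> against an event of price \<open>t\<close> wins \<open>e * t\<close> or loses \<open>e - e * t\<close>. In the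
  Dutch books below the win must be positive, and the loss at most \<open>e\<close>, half of the profit that the
  other bets guarantee when the event is true.\<close>
lemma small_stake:
  fixes e t :: real
  assumes "0 < e" "0 < t" "t \<le> 1"
  shows "0 < e * t" "e * t \<le> e"
  using assms by (simp_all add: mult_left_le)

context
  fixes S M P :: "'a::boolean_algebra"
  assumes indep: "logically_independent3 S M P"
begin

lemma resolves_atom3:
  assumes "\<A> \<subseteq> {S, M, P, - S, - M, - P, sup S M, sup S P}"
  shows "resolves (atom3 S M P) \<A>"
  unfolding resolves_def
proof (intro conjI allI impI ballI)
  fix X :: 'a assume "X \<noteq> bot" then show "\<exists>i. inf (atom3 S M P i) X \<noteq> bot" by (rule atom3_cover)
next
  fix i :: "bool \<times> bool \<times> bool" and X assume "X \<in> \<A>"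
  obtain a b c where i: "i = (a, b, c)" by (cases i)
  have "decides (atom3 S M P i) S" "decides (atom3 S M P i) M" "decides (atom3 S M P i) P"
    unfolding i by (rule decides_atom3[OF indep], simp)+
  moreover have "X \<in> {S, M, P, - S, - M, - P, sup S M, sup S P}" using assms \<open>X \<in> \<A>\<close> by blast
  ultimately show "decides (atom3 S M P i) X"
    by (auto intro!: decides_compl decides_sup simp del: atom3.simps)
qed

lemma atom3_events:
  "atom3 S M P (a, b, c) \<le> S \<longleftrightarrow> a" "atom3 S M P (a, b, c) \<le> M \<longleftrightarrow> b"
  "atom3 S M P (a, b, c) \<le> P \<longleftrightarrow> c"
  "atom3 S M P (a, b, c) \<le> - S \<longleftrightarrow> \<not> a" "atom3 S M P (a, b, c) \<le> - M \<longleftrightarrow> \<not> b"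
  "atom3 S M P (a, b, c) \<le> - P \<longleftrightarrow> \<not> c"
  "atom3 S M P (a, b, c) \<le> sup S M \<longleftrightarrow> a \<or> b" "atom3 S M P (a, b, c) \<le> sup S P \<longleftrightarrow> a \<or> c"
  using decides_atom3[OF indep, of _ a b c] atom3_le_iff[OF indep]
  by (simp_all add: decides_uminus_iff decides_sup_iff del: atom3.simps)

lemmas on_atoms = atom3_events ind_def sum_truth_assignments

text \<open>Baroco does not follow from Darii by contraposing its first premise, because \<open>M|P\<close> and the
  contrapositive \<open>\<not> P|\<not> M\<close> have different conditioning events. The bounds agree because \<open>p(M|P) = 1\<close>
  excludes \<open>\<not> M\<close> with \<open>P\<close>, so that \<open>\<not> M\<close> given \<open>S\<close> entails \<open>\<not> P\<close>.\<close>
lemma baroco: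
  fixes y1 :: real
  assumes y1: "y1 \<in> {0<..1}"
  shows "strictly_valid [(M, P), (- M, S), (S, sup S P)] (listset [{1}, {y1..1}, {0<..1}])
           (- P, S) {y1..1}"
proof (rule strictly_validI)
  let ?F = "[(M, P), (- M, S), (S, sup S P)] @ [(- P, S)]"
  have res: "resolves (atom3 S M P) (events ?F)" by (rule resolves_atom3) auto
  show "imprecise_assessment [(M, P), (- M, S), (S, sup S P)] (listset [{1}, {y1..1}, {0<..1}])"
    unfolding imprecise_assessment_def using y1 by (auto simp only: mem_listset3) auto
  show "{y1..1} \<noteq> {}" "{y1..1} \<subseteq> {0..1}" using y1 by auto
  fix z :: real
  {
    assume z: "z \<in> {y1..1}"
    define w :: "bool \<times> bool \<times> bool \<Rightarrow> real" where
      "w i = (if i = (True, False, False) then z else if i = (True, True, True) then 1 - z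
              else if i = (False, True, True) then 1 else 0)" for i
    have "coherent ?F ([1, z, 1/2] @ [z])"
      by (rule coherent_of_weights[OF res, where w = w])
        (use z y1 in \<open>auto simp del: atom3.simps simp: on_atoms w_def field_simps\<close>)
    then show "\<exists>p\<in>listset [{1}, {y1..1}, {0<..1}]. coherent ?F (p @ [z])"
      using z y1 by (intro bexI[of _ "[1, z, 1/2]"]) (simp_all add: listset3_iff del: listset.simps)
  next
    fix p assume p: "p \<in> listset [{1}, {y1..1}, {0<..1}]" and z: "z \<in> {0..1}"
      and coh: "coherent ?F (p @ [z])"
    obtain y t where pv: "p = [1, y, t]" and y: "y1 \<le> y" "y \<le> 1" and t: "0 < t" "t \<le> 1"
      using p unfolding mem_listset3 by auto
    have "y \<le> z"
    proof (rule ccontr)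
      assume less: "\<not> y \<le> z"
      obtain e where e: "e > 0" "2 * e = y - z" using less by (intro that[of "(y - z) / 2"]) auto
      obtain u where u: "u = e * t" "0 < u" "u \<le> e" using small_stake[OF e(1) t] by blast
      \<comment> \<open>Stake 3 pays for the excluded atoms, where the other bets lose less than 3.\<close>
      define s where "s = (!) [- 3, - 1, - e, 1 :: real]"
      have "\<not> coherent ?F (p @ [z])"
      proof (rule not_coherent_of_sure_gain[OF res])
        fix i assume i: "\<exists>(E, H)\<in>set ?F. atom3 S M P i \<le> H"
        obtain a b c where [simp]: "i = (a, b, c)" by (cases i)
        show "gain ?F (p @ [z]) s {..<length ?F} (atom3 S M P i) > 0"
          using i e u(2,3) z less y t y1
          by (cases a; cases b; cases c)
            (auto simp del: atom3.simps
              simp: on_atoms gain_def s_def pv lessThan_Suc algebra_simps u(1)[symmetric])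
      qed simp
      with coh show False by simp
    qed
    then show "z \<in> {y1..1}" using z y by auto
  }
qed

lemma darii:
  fixes y1 :: real
  assumes y1: "y1 \<in> {0<..1}"
  shows "strictly_valid [(P, M), (M, S), (S, sup S M)] (listset [{1}, {y1..1}, {0<..1}])
           (P, S) {y1..1}"
proof (rule strictly_validI)
  let ?F = "[(P, M), (M, S), (S, sup S M)] @ [(P, S)]"
  have res: "resolves (atom3 S M P) (events ?F)" by (rule resolves_atom3) auto
  show "imprecise_assessment [(P, M), (M, S), (S, sup S M)] (listset [{1}, {y1..1}, {0<..1}])"
    unfolding imprecise_assessment_def using y1 by (auto simp only: mem_listset3) auto
  show "{y1..1} \<noteq> {}" "{y1..1} \<subseteq> {0..1}" using y1 by auto
  fix z :: real
  {
    assume z: "z \<in> {y1..1}"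
    define w :: "bool \<times> bool \<times> bool \<Rightarrow> real" where
      "w i = (if i = (True, True, True) then z else if i = (True, False, False) then 1 - z
              else 0)" for i
    have "coherent ?F ([1, z, 1] @ [z])"
      by (rule coherent_of_weights[OF res, where w = w])
        (use z y1 in \<open>auto simp del: atom3.simps simp: on_atoms w_def field_simps\<close>)
    then show "\<exists>p\<in>listset [{1}, {y1..1}, {0<..1}]. coherent ?F (p @ [z])"
      using z y1 by (intro bexI[of _ "[1, z, 1]"]) (simp_all add: listset3_iff del: listset.simps)
  next
    fix p assume p: "p \<in> listset [{1}, {y1..1}, {0<..1}]" and z: "z \<in> {0..1}"
      and coh: "coherent ?F (p @ [z])"
    obtain y t where pv: "p = [1, y, t]" and y: "y1 \<le> y" "y \<le> 1" and t: "0 < t" "t \<le> 1"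
      using p unfolding mem_listset3 by auto
    have "y \<le> z"
    proof (rule ccontr)
      assume less: "\<not> y \<le> z"
      obtain e where e: "e > 0" "2 * e = y - z" using less by (intro that[of "(y - z) / 2"]) auto
      obtain u where u: "u = e * t" "0 < u" "u \<le> e" using small_stake[OF e(1) t] by blast
      \<comment> \<open>Stake 3 pays for the excluded atoms, where the other bets lose less than 3.\<close>
      define s where "s = (!) [- 3, - 1, - e, 1 :: real]"
      have "\<not> coherent ?F (p @ [z])"
      proof (rule not_coherent_of_sure_gain[OF res])
        fix i assume i: "\<exists>(E, H)\<in>set ?F. atom3 S M P i \<le> H"
        obtain a b c where [simp]: "i = (a, b, c)" by (cases i)
        show "gain ?F (p @ [z]) s {..<length ?F} (atom3 S M P i) > 0"
          using i e u(2,3) z less y t y1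
          by (cases a; cases b; cases c)
            (auto simp del: atom3.simps
              simp: on_atoms gain_def s_def pv lessThan_Suc algebra_simps u(1)[symmetric])
      qed simp
      with coh show False by simp
    qed
    then show "z \<in> {y1..1}" using z y by auto
  }
qed

lemma darapti:
  fixes x1 :: real
  assumes x1: "x1 \<in> {1/2<..1}"
  shows "strictly_valid [(P, M), (S, M), (M, sup S M)] (listset [{x1..1}, {x1..1}, {0<..1}])
           (P, S) {0<..1}"
proof (rule strictly_validI)
  let ?F = "[(P, M), (S, M), (M, sup S M)] @ [(P, S)]"
  have res: "resolves (atom3 S M P) (events ?F)" by (rule resolves_atom3) auto
  show "imprecise_assessment [(P, M), (S, M), (M, sup S M)] (listset [{x1..1}, {x1..1}, {0<..1}])"
    unfolding imprecise_assessment_def using x1 by (auto simp only: mem_listset3) auto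
  show "{0<..1::real} \<noteq> {}" "{0<..1} \<subseteq> {0..1::real}" using x1 by auto
  fix z :: real
  {
    assume z: "z \<in> {0<..1}"
    define w :: "bool \<times> bool \<times> bool \<Rightarrow> real" where
      "w i = (if i = (True, True, True) then z else if i = (True, False, False) then 1 - z
              else 0)" for i
    have "coherent ?F ([1, 1, z] @ [z])"
      by (rule coherent_of_weights[OF res, where w = w])
        (use z x1 in \<open>auto simp del: atom3.simps simp: on_atoms w_def field_simps\<close>)
    then show "\<exists>p\<in>listset [{x1..1}, {x1..1}, {0<..1}]. coherent ?F (p @ [z])"
      using z x1 by (intro bexI[of _ "[1, 1, z]"]) (simp_all add: listset3_iff del: listset.simps)
  next
    fix p assume p: "p \<in> listset [{x1..1}, {x1..1}, {0<..1}]" and z: "z \<in> {0..1}"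
      and coh: "coherent ?F (p @ [z])"
    obtain x x' t where pv: "p = [x, x', t]" and x: "x1 \<le> x" "x \<le> 1" "x1 \<le> x'" "x' \<le> 1"
      and t: "0 < t" "t \<le> 1"
      using p unfolding mem_listset3 by auto
    have "z \<noteq> 0"
    proof
      assume less: "z = 0"
      obtain e where e: "e > 0" "2 * e = x + x' - 1" using less x x1 by (intro that[of "(x + x' - 1) / 2"]) auto
      obtain u where u: "u = e * t" "0 < u" "u \<le> e" using small_stake[OF e(1) t] by blast
      \<comment> \<open>Stake 3 is more than the loss of the other bets on \<open>SMP\<close>, which is less than 2.\<close>
      define s where "s = (!) [- 1, - 1, - e, 3 :: real]"
      have "\<not> coherent ?F (p @ [z])"
      proof (rule not_coherent_of_sure_gain[OF res])
        fix i assume i: "\<exists>(E, H)\<in>set ?F. atom3 S M P i \<le> H"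
        obtain a b c where [simp]: "i = (a, b, c)" by (cases i)
        show "gain ?F (p @ [z]) s {..<length ?F} (atom3 S M P i) > 0"
          using i e u(2,3) z less x t
          by (cases a; cases b; cases c)
            (auto simp del: atom3.simps
              simp: on_atoms gain_def s_def pv lessThan_Suc algebra_simps u(1)[symmetric])
      qed simp
      with coh show False by simp
    qed
    then show "z \<in> {0<..1}" using z by auto
  }
qed

end

theorem mainTheorem9:
  fixes S M P :: "'a::boolean_algebra"
  assumes "logically_independent3 S M P"
  shows
    "(\<forall>y1\<in>{0<..1::real}.
        strictly_valid [(M, P), (- M, S), (S, sup S P)] (listset [{1}, {y1..1}, {0<..1}])
          (- P, S) {y1..1}) \<and>
     (\<forall>y1\<in>{0<..1::real}.
        strictly_valid [(P, M), (M, S), (S, sup S M)] (listset [{1}, {y1..1}, {0<..1}])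
          (P, S) {y1..1}) \<and>
     (\<forall>x1\<in>{1/2<..1::real}.
        strictly_valid [(P, M), (S, M), (M, sup S M)] (listset [{x1..1}, {x1..1}, {0<..1}])
          (P, S) {0<..1})"
  using baroco[OF assms] darii[OF assms] darapti[OF assms] by blast

end
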